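(* The Burau representation $\rho_3$ specialized at $t_0\in \mathbb{C}^{*}$ is faithful if and only if $-t_0 \notin \Sigma_*$.
   Context: The braid group $\mathcal{B}_3$ is generated by $\sigma_1,\sigma_2$ with the relation $\sigma_1\sigma_2\sigma_1=\sigma_2\sigma_1\sigma_2$. The (reduced) Burau representation $\rho_3:\mathcal{B}_3\to \mathrm{GL}(2,\mathbb{Z}[t,t^{-1}])$ is defined by $\sigma_1\mapsto\begin{pmatrix}-t&1\\ 0&1\end{pmatrix}$, $\sigma_2\mapsto\begin{pmatrix}1&0\\ t&-t\end{pmatrix}$. Its specialization $\rho_3^{t_0}:\mathcal{B}_3\to\mathrm{GL}(2,\mathbb{C})$ is given by the same matrices with $t$ replaced by a nonzero complex number $t_0\in\mathbb{C}^*=\mathbb{C}\setminus\{0\}$. $q$-rationals: let $R_q=\begin{pmatrix}q&1\\ 0&1\end{pmatrix}$, $L_q=\begin{pmatrix}1&0\\ 1&q^{-1}\end{pmatrix}$, with $R=R_q|_{q=1}$, $L=L_q|_{q=1}$ the standard generators of $\mathrm{SL}(2,\mathbb{Z})$. For $M=\begin{pmatrix}r&v\\ s&u\end{pmatrix}=R^{a_1}L^{a_2}\cdots R^{a_{2m-1}}L^{a_{2m}}\in\mathrm{SL}(2,\mathbb{Z})$, let $M_q=R_q^{a_1}L_q^{a_2}\cdots R_q^{a_{2m-1}}L_q^{a_{2m}}=\begin{pmatrix}\mathcal{R}&\mathcal{V}\\ \mathcal{S}&\mathcal{U}\end{pmatrix}$, with Laurent polynomial entries in $q$. The $q$-deformation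 of the rational $\frac{r}{s}$ (first column of $M$) is $\left[\frac{r}{s}\right]_q=\frac{\mathcal{R}(q)}{\mathcal{S}(q)}$ (independent of choices). The singular set $\Sigma\subset\mathbb{C}^*$ is the union of the complex poles of all $q$-rationals $\left[\frac{r}{s}\right]_q$, $\frac{r}{s}\in\mathbb{Q}$, and the extended singular set is $\Sigma_*=\Sigma\cup\{1\}$. *)

theory Defs
  imports "HOL-Complex_Analysis.Complex_Analysis"
begin

type_synonym cmat2 = "complex^2^2"

definition mk2 :: "complex \<Rightarrow> complex \<Rightarrow> complex \<Rightarrow> complex \<Rightarrow> cmat2" where
  "mk2 a b c d = (\<chi> i j. if i = 1 then (if j = 1 then a else b) else (if j = 1 then c else d))"

section \<open>The braid group B_3, presented by generators and relations\<close>

datatype gen = S1 | S2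

text \<open>A braid word: a list of letters (g, True) = sigma_g, (g, False) = sigma_g inverse.\<close>
type_synonym bword = "(gen \<times> bool) list"

text \<open>Equality in B_3 = congruence on words generated by free cancellation and the braid relation.\<close>
inductive braid_eq :: "bword \<Rightarrow> bword \<Rightarrow> bool" where
  refl: "braid_eq w w"
| sym: "braid_eq u w \<Longrightarrow> braid_eq w u"
| trans: "braid_eq u v \<Longrightarrow> braid_eq v w \<Longrightarrow> braid_eq u w"
| cong: "braid_eq u w \<Longrightarrow> braid_eq (x @ u @ y) (x @ w @ y)"
| cancel: "braid_eq [(g, b), (g, \<not> b)] []"
| braid: "braid_eq [(S1, True), (S2, True), (S1, True)] [(S2, True), (S1, True), (S2, True)]"

section \<open>Reduced Burau representation specialised at t\<close>

fun burau_gen :: "complex \<Rightarrow> gen \<times> bool \<Rightarrow> cmat2" where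
  "burau_gen t (S1, True) = mk2 (-t) 1 0 1"
| "burau_gen t (S1, False) = mk2 (-1/t) (1/t) 0 1"
| "burau_gen t (S2, True) = mk2 1 0 t (-t)"
| "burau_gen t (S2, False) = mk2 1 0 1 (-1/t)"

definition burau :: "complex \<Rightarrow> bword \<Rightarrow> cmat2" where
  "burau t w = foldr (\<lambda>x A. burau_gen t x ** A) w (mat 1)"

text \<open>Faithfulness of the specialisation: injective on B_3.\<close>
definition burau_faithful :: "complex \<Rightarrow> bool" where
  "burau_faithful t \<longleftrightarrow> (\<forall>w1 w2. burau t w1 = burau t w2 \<longrightarrow> braid_eq w1 w2)"

section \<open>q-rationals and the singular set\<close>

definition Rq :: "complex \<Rightarrow> cmat2" where "Rq q = mk2 q 1 0 1"
definition Rq_inv :: "complex \<Rightarrow> cmat2" where "Rq_inv q = mk2 (1/q) (-1/q) 0 1"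
definition Lq :: "complex \<Rightarrow> cmat2" where "Lq q = mk2 1 0 1 (1/q)"
definition Lq_inv :: "complex \<Rightarrow> cmat2" where "Lq_inv q = mk2 1 0 (-q) q"

text \<open>Integer power of a matrix given the matrix and its inverse.\<close>
definition ipow :: "cmat2 \<Rightarrow> cmat2 \<Rightarrow> int \<Rightarrow> cmat2" where
  "ipow A Ainv k = (if 0 \<le> k then foldr (**) (replicate (nat k) A) (mat 1)
                    else foldr (**) (replicate (nat (-k)) Ainv) (mat 1))"

text \<open>M_q = R_q^{a1} L_q^{a2} ... R_q^{a(2m-1)} L_q^{a(2m)}, exponents given as list of pairs.\<close>
definition Mq :: "(int \<times> int) list \<Rightarrow> complex \<Rightarrow> cmat2" where
  "Mq as q = foldr (\<lambda>(a, b) A. ipow (Rq q) (Rq_inv q) a ** ipow (Lq q) (Lq_inv q) b ** A) as (mat 1)"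

text \<open>Entry (1,1) is the q-numerator, entry (2,1) the q-denominator; at q = 1 we get M itself.\<close>
definition qnum :: "(int \<times> int) list \<Rightarrow> complex \<Rightarrow> complex" where "qnum as q = Mq as q $ 1 $ 1"
definition qden :: "(int \<times> int) list \<Rightarrow> complex \<Rightarrow> complex" where "qden as q = Mq as q $ 2 $ 1"

text \<open>Singular set: complex poles (in C^*) of q-rationals [r/s]_q, s \<noteq> 0.\<close>
definition singular_set :: "complex set" where
  "singular_set = {q0. q0 \<noteq> 0 \<and> (\<exists>as. qden as 1 \<noteq> 0 \<and> is_pole (\<lambda>q. qnum as q / qden as q) q0)}"

definition ext_singular_set :: "complex set" where
  "ext_singular_set = singular_set \<union> {1}"

end

(* Substituting q = -t turns the Burau matrices of sigma_1 and sigma_2^-1 into R_q and L_q, so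
   the Burau image of a braid at t is M_q at q = -t, where M in SL(2,Z) is its image at t = -1.

   Let -t0 be outside Sigma_* and let beta lie in the kernel at t0. Then M_q = I at q = -t0, so the
   lower left entry s of M vanishes, since otherwise [r/s]_q would have a pole at -t0. The same
   holds for the conjugates of beta by sigma_2, which forces M = +-I. Modulo its centre, generated
   by Delta^2, B_3 is Z/2 * Z/3 (normal form and ping-pong), so beta = Delta^2k. Its image t0^3k I
   is trivial only for k = 0, as otherwise -t0 is a root of unity other than 1, hence a pole of
   some [1/m]_q.

   Conversely, Delta^4 lies in the kernel at t0 = -1, and a pole at -t0 yields a braid beta that is
   upper triangular at t0 but not at -1. The commutator U = [beta, sigma_1] and its conjugate by
   sigma_1 are then unitriangular, hence commute, at t0, but they do not commute at -1. *)

theory Submission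
  imports Defs
begin

no_notation fps_nth (infixl \<open>$\<close> 75)

section \<open>Two by two matrices\<close>

lemma mk2_nth [simp]:
  "mk2 a b c d $ 1 $ 1 = a" "mk2 a b c d $ 1 $ 2 = b" "mk2 a b c d $ 2 $ 1 = c" "mk2 a b c d $ 2 $ 2 = d"
  by (simp_all add: mk2_def)

lemma cmat2_eq_iff:
  "(A::cmat2) = B \<longleftrightarrow> A$1$1 = B$1$1 \<and> A$1$2 = B$1$2 \<and> A$2$1 = B$2$1 \<and> A$2$2 = B$2$2"
  by (auto simp: vec_eq_iff forall_2)

lemma mk2_entries: "(A::cmat2) = mk2 (A$1$1) (A$1$2) (A$2$1) (A$2$2)"
  by (simp add: cmat2_eq_iff)

lemma mk2_eq_iff [simp]: "mk2 a b c d = mk2 a' b' c' d' \<longleftrightarrow> a = a' \<and> b = b' \<and> c = c' \<and> d = d'"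
  by (simp add: cmat2_eq_iff)

lemma mk2_mult [simp]: "mk2 a b c d ** mk2 e f g h = mk2 (a*e+b*g) (a*f+b*h) (c*e+d*g) (c*f+d*h)"
  by (simp add: cmat2_eq_iff matrix_matrix_mult_def sum_2)

lemma mat_1_eq_mk2: "(mat 1 :: cmat2) = mk2 1 0 0 1"
  by (simp add: cmat2_eq_iff mat_def)

lemma det_mk2 [simp]: "det (mk2 a b c d) = a * d - b * c"
  by (simp add: det_2)

lemma inverse_eq_adjugate:
  assumes "M ** N = mat 1" "det M = 1"
  shows "N = mk2 (M$2$2) (- M$1$2) (- M$2$1) (M$1$1)"
proof -
  let ?adj = "mk2 (M$2$2) (- M$1$2) (- M$2$1) (M$1$1)"
  obtain a b c d where M: "M = mk2 a b c d" using mk2_entries by blast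
  have "?adj ** M = mat 1"
    using assms(2) by (simp add: M mat_1_eq_mk2 algebra_simps)
  then have "N = (?adj ** M) ** N" by simp
  also have "\<dots> = ?adj" by (simp add: matrix_mul_assoc[symmetric] assms(1))
  finally show ?thesis .
qed

section \<open>Braid words\<close>

abbreviation sig1 :: "gen \<times> bool" where "sig1 \<equiv> (S1, True)"
abbreviation sig1_inv :: "gen \<times> bool" where "sig1_inv \<equiv> (S1, False)"
abbreviation sig2 :: "gen \<times> bool" where "sig2 \<equiv> (S2, True)"
abbreviation sig2_inv :: "gen \<times> bool" where "sig2_inv \<equiv> (S2, False)"

declare braid_eq.refl [simp] braid_eq.trans [trans]

definition word_inv :: "bword \<Rightarrow> bword" where
  "word_inv w = rev (map (\<lambda>(g, b). (g, \<not> b)) w)"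

lemma word_inv_simps [simp]:
  "word_inv [] = []"
  "word_inv (x # w) = word_inv w @ [(fst x, \<not> snd x)]"
  "word_inv (u @ w) = word_inv w @ word_inv u"
  by (auto simp: word_inv_def case_prod_beta)

lemma word_inv_word_inv [simp]: "word_inv (word_inv w) = w"
  by (induction w) auto

lemma braid_eq_cancel: "braid_eq (x @ [(g, b), (g, \<not> b)] @ y) (x @ y)"
  using braid_eq.cong[OF braid_eq.cancel[of g b], of x y] by simp

lemma braid_eq_append: "braid_eq u u' \<Longrightarrow> braid_eq v v' \<Longrightarrow> braid_eq (u @ v) (u' @ v')"
  using braid_eq.cong[of u u' "[]" v] braid_eq.cong[of v v' u' "[]"] by (auto intro: braid_eq.trans)

lemma braid_eq_word_inv_right: "braid_eq (w @ word_inv w) []"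
proof (induction w)
  case (Cons x w)
  have "braid_eq ([x] @ (w @ word_inv w) @ [(fst x, \<not> snd x)]) ([x] @ [] @ [(fst x, \<not> snd x)])"
    by (rule braid_eq.cong[OF Cons.IH])
  also have "braid_eq \<dots> []"
    using braid_eq_cancel[of "[]" "fst x" "snd x" "[]"] by simp
  finally show ?case by simp
qed simp

lemma braid_eq_word_inv_left: "braid_eq (word_inv w @ w) []"
  using braid_eq_word_inv_right[of "word_inv w"] by simp

definition exp_sum :: "bword \<Rightarrow> int" where
  "exp_sum w = (\<Sum>x\<leftarrow>w. if snd x then 1 else -1)"

lemma exp_sum_braid_eq: "braid_eq u w \<Longrightarrow> exp_sum u = exp_sum w"
  by (induction rule: braid_eq.induct) (auto simp: exp_sum_def)

lemma burau_Nil [simp]: "burau t [] = mat 1"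
  by (simp add: burau_def)

lemma burau_Cons [simp]: "burau t (x # w) = burau_gen t x ** burau t w"
  by (simp add: burau_def)

lemma burau_append [simp]: "burau t (u @ w) = burau t u ** burau t w"
  by (induction u) (auto simp: matrix_mul_assoc)

lemma burau_braid_eq:
  assumes "braid_eq u w" "t \<noteq> 0"
  shows "burau t u = burau t w"
  using assms(1)
proof induction
  case (cancel g b)
  show ?case using assms(2) by (cases g; cases b) (auto simp: mat_1_eq_mk2 field_simps)
qed (auto simp: algebra_simps)

lemma burau_word_inv_right: "t \<noteq> 0 \<Longrightarrow> burau t w ** burau t (word_inv w) = mat 1"
  using burau_braid_eq[OF braid_eq_word_inv_right] by fastforce

lemma burau_word_inv_left: "t \<noteq> 0 \<Longrightarrow> burau t (word_inv w) ** burau t w = mat 1"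
  using burau_braid_eq[OF braid_eq_word_inv_left] by fastforce

lemma det_burau_minus_one: "det (burau (-1) w) = 1"
proof (induction w)
  case (Cons x w)
  have "det (burau_gen (-1) x) = 1"
    by (cases x; cases "fst x"; cases "snd x") simp_all
  with Cons show ?case by (simp add: det_mul)
qed (simp add: mat_1_eq_mk2)

section \<open>Burau matrices as q-deformed matrices\<close>

lemma Mq_Nil [simp]: "Mq [] q = mat 1"
  by (simp add: Mq_def)

lemma Mq_Cons [simp]:
  "Mq ((a, b) # as) q = ipow (Rq q) (Rq_inv q) a ** ipow (Lq q) (Lq_inv q) b ** Mq as q"
  by (simp add: Mq_def)

lemma Mq_append [simp]: "Mq (as @ bs) q = Mq as q ** Mq bs q"
  by (induction as) (auto simp: matrix_mul_assoc)

lemma burau_gen_eq_Rq_Lq: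
  assumes "t \<noteq> 0"
  shows "burau_gen t sig1 = Rq (-t)" "burau_gen t sig1_inv = Rq_inv (-t)"
    "burau_gen t sig2_inv = Lq (-t)" "burau_gen t sig2 = Lq_inv (-t)"
  using assms by (auto simp: Rq_def Rq_inv_def Lq_def Lq_inv_def field_simps)

fun letter_exps :: "gen \<times> bool \<Rightarrow> int \<times> int" where
  "letter_exps (S1, b) = (if b then 1 else -1, 0)"
| "letter_exps (S2, b) = (0, if b then -1 else 1)"

lemma burau_eq_Mq: "t \<noteq> 0 \<Longrightarrow> burau t w = Mq (map letter_exps w) (-t)"
proof (induction w)
  case (Cons x w)
  have gen: "burau_gen t x = Mq [letter_exps x] (-t)"
    using burau_gen_eq_Rq_Lq[OF Cons.prems]
    by (cases x; cases "fst x"; cases "snd x") (auto simp: ipow_def)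
  have "burau t (x # w) = Mq ([letter_exps x] @ map letter_exps w) (-t)"
    by (simp only: burau_Cons Mq_append gen Cons.IH[OF Cons.prems])
  then show ?case by simp
qed simp

definition sig1_pow :: "int \<Rightarrow> bword" where
  "sig1_pow a = (if 0 \<le> a then replicate (nat a) sig1 else replicate (nat (-a)) sig1_inv)"

definition sig2_inv_pow :: "int \<Rightarrow> bword" where
  "sig2_inv_pow b = (if 0 \<le> b then replicate (nat b) sig2_inv else replicate (nat (-b)) sig2)"

definition exps_word :: "(int \<times> int) list \<Rightarrow> bword" where
  "exps_word as = concat (map (\<lambda>(a, b). sig1_pow a @ sig2_inv_pow b) as)"

lemma burau_replicate: "burau t (replicate n x) = foldr (**) (replicate n (burau_gen t x)) (mat 1)"
  by (induction n) auto

lemma burau_exps_word: "t \<noteq> 0 \<Longrightarrow> burau t (exps_word as) = Mq as (-t)"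
  by (induction as)
    (auto simp: exps_word_def sig1_pow_def sig2_inv_pow_def ipow_def burau_replicate
      burau_gen_eq_Rq_Lq matrix_mul_assoc simp del: burau_gen.simps foldr_replicate)

section \<open>Poles of q-rationals\<close>

definition entries_holomorphic :: "(complex \<Rightarrow> cmat2) \<Rightarrow> bool" where
  "entries_holomorphic F \<longleftrightarrow> (\<forall>i j. (\<lambda>q. F q $ i $ j) holomorphic_on - {0})"

lemma entries_holomorphic_mult:
  "entries_holomorphic F \<Longrightarrow> entries_holomorphic G \<Longrightarrow> entries_holomorphic (\<lambda>q. F q ** G q)"
  unfolding entries_holomorphic_def matrix_matrix_mult_def
  by (auto intro!: holomorphic_intros)

lemma entries_holomorphic_mk2:
  assumes "a holomorphic_on - {0}" "b holomorphic_on - {0}"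
    "c holomorphic_on - {0}" "d holomorphic_on - {0}"
  shows "entries_holomorphic (\<lambda>q. mk2 (a q) (b q) (c q) (d q))"
  using assms by (auto simp: entries_holomorphic_def forall_2)

lemma entries_holomorphic_one: "entries_holomorphic (\<lambda>q. mat 1)"
  unfolding mat_1_eq_mk2 by (rule entries_holomorphic_mk2) auto

lemma entries_holomorphic_ipow:
  assumes "entries_holomorphic F" "entries_holomorphic G"
  shows "entries_holomorphic (\<lambda>q. ipow (F q) (G q) k)"
proof -
  have "entries_holomorphic (\<lambda>q. foldr (**) (replicate n (H q)) (mat 1))"
    if "entries_holomorphic H" for H n
    by (induction n) (auto intro: entries_holomorphic_mult entries_holomorphic_one that)
  then show ?thesis
    using assms unfolding ipow_def by (cases "0 \<le> k") (simp_all del: foldr_replicate)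
qed

lemma entries_holomorphic_Mq: "entries_holomorphic (Mq as)"
proof (induction as)
  case Nil
  then show ?case using entries_holomorphic_one by simp
next
  case (Cons p as)
  have gens: "entries_holomorphic Rq" "entries_holomorphic Rq_inv"
    "entries_holomorphic Lq" "entries_holomorphic Lq_inv"
    unfolding Rq_def Rq_inv_def Lq_def Lq_inv_def
    by (rule entries_holomorphic_mk2; auto intro!: holomorphic_intros)+
  show ?case
    using entries_holomorphic_mult[OF entries_holomorphic_mult Cons.IH]
      entries_holomorphic_ipow[OF gens(1,2)] entries_holomorphic_ipow[OF gens(3,4)]
    by (cases p) auto
qed

lemma qnum_holomorphic: "qnum as holomorphic_on - {0}"
  and qden_holomorphic: "qden as holomorphic_on - {0}"
  using entries_holomorphic_Mq[of as] unfolding entries_holomorphic_def qnum_def qden_def by blast+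

lemma isCont_holomorphic_punctured: "f holomorphic_on - {0} \<Longrightarrow> (z::complex) \<noteq> 0 \<Longrightarrow> isCont f z"
  by (metis holomorphic_on_imp_continuous_on continuous_on_eq_continuous_at open_Compl
      ComplI closed_singleton singletonD)

lemma in_singular_setI:
  assumes "q0 \<noteq> 0" "qden as 1 \<noteq> 0" "qden as q0 = 0" "qnum as q0 \<noteq> 0"
  shows "q0 \<in> singular_set"
proof -
  have "open (- {0::complex})" "connected (- {0::complex})"
    by (auto intro: connected_punctured_universe)
  then obtain r where "0 < r" "ball q0 r \<subseteq> - {0}" "\<And>z. z \<in> ball q0 r - {q0} \<Longrightarrow> qden as z \<noteq> 0"
    using isolated_zeros[OF qden_holomorphic[of as], of q0 1] assms by auto
  then have "eventually (\<lambda>z. qden as z \<noteq> 0) (at q0)"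
    unfolding eventually_at by (auto simp: dist_commute)
  moreover have "(qden as \<longlongrightarrow> 0) (at q0)"
    using isCont_holomorphic_punctured[OF qden_holomorphic[of as] assms(1)] assms(3) by (simp add: isCont_def)
  ultimately have "filterlim (qden as) (at 0) (at q0)"
    by (rule filterlim_atI[rotated])
  moreover have "(qnum as \<longlongrightarrow> qnum as q0) (at q0)"
    using isCont_holomorphic_punctured[OF qnum_holomorphic[of as] assms(1)] by (simp add: isCont_def)
  ultimately have "is_pole (\<lambda>q. qnum as q / qden as q) q0"
    unfolding is_pole_def using assms(4) by (intro filterlim_divide_at_infinity)
  then show ?thesis
    using assms unfolding singular_set_def by auto
qed

lemma qden_eq_0_at_pole:
  assumes "q0 \<noteq> 0" "is_pole (\<lambda>q. qnum as q / qden as q) q0"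
  shows "qden as q0 = 0"
proof (rule ccontr)
  assume "qden as q0 \<noteq> 0"
  then have "((\<lambda>q. qnum as q / qden as q) \<longlongrightarrow> qnum as q0 / qden as q0) (at q0)"
    using isCont_holomorphic_punctured[OF qnum_holomorphic[of as] assms(1)]
      isCont_holomorphic_punctured[OF qden_holomorphic[of as] assms(1)]
    by (intro tendsto_divide) (auto simp: isCont_def)
  with assms(2) show False
    unfolding is_pole_def using not_tendsto_and_filterlim_at_infinity trivial_limit_at by blast
qed

lemma Lq_pow: "Mq [(0, int m)] q = mk2 1 0 (\<Sum>j<m. (1/q)^j) ((1/q)^m)"
proof -
  have "foldr (**) (replicate m (Lq q)) (mat 1) = mk2 1 0 (\<Sum>j<m. (1/q)^j) ((1/q)^m)"
  proof (induction m)
    case (Suc m)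
    have "(\<Sum>j<Suc m. (1/q)^j) = 1 + (1/q) * (\<Sum>j<m. (1/q)^j)"
      by (simp add: sum.lessThan_Suc_shift sum_distrib_left del: sum.lessThan_Suc)
    with Suc show ?case by (simp add: Lq_def algebra_simps del: foldr_replicate)
  qed (simp add: mat_1_eq_mk2)
  then show ?thesis by (simp add: ipow_def del: foldr_replicate)
qed

text \<open>The witness is \<open>[1/m]\<^sub>q\<close>, whose denominator \<open>1 + q\<inverse> + \<dots> + q\<^sup>1\<^sup>-\<^sup>m\<close> vanishes
  at the nontrivial \<open>m\<close>-th roots of unity.\<close>

lemma root_of_unity_in_singular_set:
  assumes "q0 ^ m = 1" "q0 \<noteq> 1" "m > 0"
  shows "q0 \<in> singular_set"
proof (rule in_singular_setI[of q0 "[(0, int m)]"])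
  show "q0 \<noteq> 0" using assms(1,3) by (auto simp: power_0_left)
  show "qden [(0, int m)] 1 \<noteq> 0" using assms(3) unfolding qden_def Lq_pow by simp
  show "qnum [(0, int m)] q0 \<noteq> 0" unfolding qnum_def Lq_pow by simp
  have "1 / q0 \<noteq> 1" "(1 / q0) ^ m = 1"
    using assms(1,2) by (auto simp: power_one_over)
  then show "qden [(0, int m)] q0 = 0"
    using geometric_sum[of "1 / q0" m] unfolding qden_def Lq_pow by simp
qed

section \<open>The centre\<close>

definition half_twist :: bword where "half_twist = [sig1, sig2, sig1]"

definition full_twist :: bword where "full_twist = half_twist @ half_twist"

fun swap_gen :: "gen \<Rightarrow> gen" where
  "swap_gen S1 = S2"
| "swap_gen S2 = S1"

lemma half_twist_letter: "braid_eq (half_twist @ [(g, True)]) ((swap_gen g, True) # half_twist)"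
proof (cases g)
  case S1
  then show ?thesis
    using braid_eq.cong[OF braid_eq.braid, of "[]" "[sig1]"] by (simp add: half_twist_def)
next
  case S2
  then show ?thesis
    using braid_eq.cong[OF braid_eq.sym[OF braid_eq.braid], of "[sig1]" "[]"]
    by (simp add: half_twist_def)
qed

lemma commute_inv_letter:
  assumes "braid_eq (u @ [(g, True)]) ((g, True) # u)"
  shows "braid_eq (u @ [(g, False)]) ((g, False) # u)"
proof -
  have "braid_eq ((g, False) # u) ([(g, False)] @ (u @ [(g, True)]) @ [(g, False)])"
    using braid_eq.sym[OF braid_eq_cancel[of "[(g, False)] @ u" g True "[]"]] by simp
  also have "braid_eq \<dots> ([(g, False)] @ ((g, True) # u) @ [(g, False)])"
    by (rule braid_eq.cong[OF assms])
  also have "braid_eq \<dots> (u @ [(g, False)])"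
    using braid_eq_cancel[of "[]" g False "u @ [(g, False)]"] by simp
  finally show ?thesis by (rule braid_eq.sym)
qed

lemma full_twist_letter_commute: "braid_eq (full_twist @ [x]) (x # full_twist)"
proof -
  have "braid_eq (full_twist @ [(g, True)]) ((g, True) # full_twist)" for g
  proof -
    have "braid_eq (half_twist @ half_twist @ [(g, True)]) (half_twist @ (swap_gen g, True) # half_twist)"
      by (rule braid_eq_append[OF braid_eq.refl half_twist_letter])
    also have "braid_eq \<dots> (((swap_gen (swap_gen g), True) # half_twist) @ half_twist)"
      using braid_eq_append[OF half_twist_letter braid_eq.refl, of "swap_gen g" half_twist] by simp
    finally show ?thesis by (cases g) (simp_all add: full_twist_def)
  qed
  then show ?thesis
    using commute_inv_letter by (cases x; cases "snd x") fastforce+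
qed

lemma full_twist_central: "braid_eq (full_twist @ u) (u @ full_twist)"
proof (induction u)
  case (Cons x u)
  have "braid_eq ((full_twist @ [x]) @ u) ((x # full_twist) @ u)"
    by (rule braid_eq_append[OF full_twist_letter_commute braid_eq.refl])
  also have "braid_eq \<dots> ([x] @ u @ full_twist)"
    using braid_eq_append[OF braid_eq.refl Cons.IH, of "[x]"] by simp
  finally show ?case by simp
qed simp

lemma word_inv_central:
  assumes "\<And>u. braid_eq (z @ u) (u @ z)"
  shows "braid_eq (word_inv z @ u) (u @ word_inv z)"
proof -
  have "braid_eq (word_inv z @ u) ((word_inv z @ u) @ z @ word_inv z)"
    using braid_eq_append[OF braid_eq.refl braid_eq.sym[OF braid_eq_word_inv_right],
        of "word_inv z @ u" z] by simp
  also have "braid_eq \<dots> (word_inv z @ (z @ u) @ word_inv z)"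
    using braid_eq.cong[OF braid_eq.sym[OF assms], of "word_inv z" u "word_inv z"] by simp
  also have "braid_eq \<dots> (u @ word_inv z)"
    using braid_eq_append[OF braid_eq_word_inv_left braid_eq.refl, of z "u @ word_inv z"] by simp
  finally show ?thesis .
qed

definition word_pow :: "bword \<Rightarrow> int \<Rightarrow> bword" where
  "word_pow w k = (if 0 \<le> k then concat (replicate (nat k) w)
                   else concat (replicate (nat (-k)) (word_inv w)))"

lemma word_pow_0 [simp]: "word_pow w 0 = []"
  by (simp add: word_pow_def)

lemma concat_replicate_append_same: "concat (replicate n w) @ w = w @ concat (replicate n w)"
  by (induction n) auto

lemma word_pow_word_inv: "word_pow (word_inv w) k = word_pow w (-k)"
  by (cases "k = 0") (auto simp: word_pow_def)

lemma word_pow_append_self: "braid_eq (word_pow w k @ w) (word_pow w (k + 1))"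
proof (cases "0 \<le> k")
  case True
  then have "nat (k + 1) = Suc (nat k)" by simp
  with True show ?thesis by (simp add: word_pow_def concat_replicate_append_same)
next
  case False
  then obtain n where n: "nat (-k) = Suc n" "nat (-(k + 1)) = n"
    by (intro that[of "nat (-k - 1)"]) auto
  have "word_pow w k @ w = concat (replicate n (word_inv w)) @ (word_inv w @ w) @ []"
    using False n by (simp add: word_pow_def concat_replicate_append_same)
  also have "braid_eq \<dots> (concat (replicate n (word_inv w)) @ [] @ [])"
    by (rule braid_eq.cong[OF braid_eq_word_inv_left])
  also have "\<dots> = word_pow w (k + 1)"
    using False n by (auto simp: word_pow_def)
  finally show ?thesis .
qed

lemma word_pow_append_inv: "braid_eq (word_pow w k @ word_inv w) (word_pow w (k - 1))"
  using word_pow_append_self[of "word_inv w" "-k"] by (simp add: word_pow_word_inv)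

lemma full_twist_pow_absorb:
  "braid_eq (word_pow full_twist k @ u @ full_twist @ v) (word_pow full_twist (k + 1) @ u @ v)"
proof -
  have "braid_eq (word_pow full_twist k @ (u @ full_twist) @ v) (word_pow full_twist k @ (full_twist @ u) @ v)"
    by (rule braid_eq.cong[OF braid_eq.sym[OF full_twist_central]])
  also have "braid_eq \<dots> (word_pow full_twist (k + 1) @ u @ v)"
    using braid_eq_append[OF word_pow_append_self braid_eq.refl, of full_twist k "u @ v"] by simp
  finally show ?thesis by simp
qed

lemma full_twist_pow_absorb_inv:
  "braid_eq (word_pow full_twist k @ u @ word_inv full_twist @ v) (word_pow full_twist (k - 1) @ u @ v)"
proof -
  have "braid_eq (word_pow full_twist k @ (u @ word_inv full_twist) @ v)
      (word_pow full_twist k @ (word_inv full_twist @ u) @ v)"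
    by (rule braid_eq.cong[OF braid_eq.sym[OF word_inv_central[OF full_twist_central]]])
  also have "braid_eq \<dots> (word_pow full_twist (k - 1) @ u @ v)"
    using braid_eq_append[OF word_pow_append_inv braid_eq.refl, of full_twist k "u @ v"] by simp
  finally show ?thesis by simp
qed

lemma burau_full_twist: "burau t full_twist = mk2 (t^3) 0 0 (t^3)"
  by (simp add: full_twist_def half_twist_def mat_1_eq_mk2 algebra_simps power3_eq_cube)

lemma burau_word_pow_scalar:
  assumes "t \<noteq> 0" "burau t w = mk2 s 0 0 s"
  shows "burau t (word_pow w k) = mk2 (s powi k) 0 0 (s powi k)"
proof -
  have "burau t (concat (replicate n v)) = mk2 (c ^ n) 0 0 (c ^ n)"
    if "burau t v = mk2 c 0 0 c" for v c n
    using that by (induction n) (simp_all add: mat_1_eq_mk2)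
  moreover have "burau t (word_inv w) = mk2 (1/s) 0 0 (1/s)"
  proof -
    have s: "s \<noteq> 0"
      using burau_word_inv_left[OF assms(1), of w] assms(2)
      by (subst (asm) mk2_entries[of "burau t (word_inv w)"]) (auto simp: mat_1_eq_mk2)
    have "burau t (word_inv w) = burau t (word_inv w) ** (burau t w ** mk2 (1/s) 0 0 (1/s))"
      using s by (simp add: assms(2) mat_1_eq_mk2[symmetric])
    also have "\<dots> = mk2 (1/s) 0 0 (1/s)"
      by (simp only: matrix_mul_assoc burau_word_inv_left[OF assms(1)] matrix_mul_lid)
    finally show ?thesis .
  qed
  ultimately show ?thesis
    using assms(2) by (simp add: word_pow_def power_int_def power_one_over inverse_eq_divide)
qed

section \<open>A normal form modulo the centre\<close>

text \<open>\<open>B\<^sub>3\<close> modulo the centre is \<open>\<langle>x\<rangle> * \<langle>y\<rangle> = \<int>/2 * \<int>/3\<close> with \<open>x = \<sigma>\<^sub>1\<sigma>\<^sub>2\<sigma>\<^sub>1\<close> and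
  \<open>y = \<sigma>\<^sub>1\<sigma>\<^sub>2\<close>; a syllable is one of \<open>x, y, y\<^sup>2\<close>.\<close>

datatype syllable = Sx | Sy | Syy

fun syl_word :: "syllable \<Rightarrow> bword" where
  "syl_word Sx = half_twist"
| "syl_word Sy = [sig1, sig2]"
| "syl_word Syy = [sig1, sig2, sig1, sig2]"

fun is_y :: "syllable \<Rightarrow> bool" where
  "is_y Sx \<longleftrightarrow> False"
| "is_y Sy \<longleftrightarrow> True"
| "is_y Syy \<longleftrightarrow> True"

abbreviation alternating :: "syllable list \<Rightarrow> bool" where
  "alternating \<equiv> successively (\<lambda>s s'. is_y s \<noteq> is_y s')"

text \<open>The syllables are stored in reverse order, so that \<open>push_syl\<close> only inspects the head.\<close>

fun nf_word :: "int \<times> syllable list \<Rightarrow> bword" where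
  "nf_word (k, r) = word_pow full_twist k @ concat (map syl_word (rev r))"

fun push_syl :: "syllable \<Rightarrow> int \<times> syllable list \<Rightarrow> int \<times> syllable list" where
  "push_syl Sx (k, Sx # r) = (k + 1, r)"
| "push_syl Sx (k, r) = (k, Sx # r)"
| "push_syl Sy (k, Sy # r) = (k, Syy # r)"
| "push_syl Sy (k, Syy # r) = (k + 1, r)"
| "push_syl Sy (k, r) = (k, Sy # r)"
| "push_syl Syy (k, Sy # r) = (k + 1, r)"
| "push_syl Syy (k, Syy # r) = (k + 1, Sy # r)"
| "push_syl Syy (k, r) = (k, Syy # r)"

lemma syl_word_products:
  "braid_eq (syl_word Sx @ syl_word Sx) (full_twist @ [])"
  "braid_eq (syl_word Sy @ syl_word Syy) (full_twist @ [])"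
  "braid_eq (syl_word Syy @ syl_word Sy) (full_twist @ [])"
  "braid_eq (syl_word Syy @ syl_word Syy) (full_twist @ syl_word Sy)"
proof -
  have yyy: "braid_eq [sig1, sig2, sig1, sig2, sig1, sig2] full_twist"
    using braid_eq.cong[OF braid_eq.sym[OF braid_eq.braid], of "[sig1, sig2, sig1]" "[]"]
    by (simp add: full_twist_def half_twist_def)
  show "braid_eq (syl_word Sx @ syl_word Sx) (full_twist @ [])"
    by (simp add: full_twist_def)
  show "braid_eq (syl_word Sy @ syl_word Syy) (full_twist @ [])"
    "braid_eq (syl_word Syy @ syl_word Sy) (full_twist @ [])"
    using yyy by simp_all
  show "braid_eq (syl_word Syy @ syl_word Syy) (full_twist @ syl_word Sy)"
    using braid_eq_append[OF yyy braid_eq.refl, of "[sig1, sig2]"] by simp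
qed

lemma nf_word_absorb:
  assumes "braid_eq (syl_word h @ syl_word s) (full_twist @ v)"
  shows "braid_eq (nf_word (k, h # r) @ syl_word s) (nf_word (k + 1, r) @ v)"
proof -
  let ?G = "concat (map syl_word (rev r))"
  have "braid_eq ((word_pow full_twist k @ ?G) @ (syl_word h @ syl_word s) @ [])
      ((word_pow full_twist k @ ?G) @ (full_twist @ v) @ [])"
    by (rule braid_eq.cong[OF assms])
  also have "braid_eq \<dots> (word_pow full_twist (k + 1) @ ?G @ v)"
    using full_twist_pow_absorb[of k ?G v] by simp
  finally show ?thesis by simp
qed

lemma push_syl_braid_eq: "braid_eq (nf_word st @ syl_word s) (nf_word (push_syl s st))"
proof -
  obtain k r where st: "st = (k, r)" by force
  show ?thesis
  proof (cases r)
    case (Cons h r')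
    show ?thesis
      using nf_word_absorb[OF syl_word_products(1), of k r']
        nf_word_absorb[OF syl_word_products(2), of k r']
        nf_word_absorb[OF syl_word_products(3), of k r']
        nf_word_absorb[OF syl_word_products(4), of k r']
      by (cases s; cases h) (simp_all add: st Cons)
  qed (cases s; simp add: st)
qed

fun letter_syls :: "gen \<times> bool \<Rightarrow> syllable \<times> syllable" where
  "letter_syls (S1, True) = (Syy, Sx)"
| "letter_syls (S1, False) = (Sx, Sy)"
| "letter_syls (S2, True) = (Sx, Syy)"
| "letter_syls (S2, False) = (Sy, Sx)"

lemma full_twist_letter:
  "braid_eq (full_twist @ [x]) (syl_word (fst (letter_syls x)) @ syl_word (snd (letter_syls x)))"
proof (cases x rule: letter_syls.cases)
  case 1
  then show ?thesis
    using braid_eq.cong[OF braid_eq.braid, of "[sig1, sig2, sig1]" "[sig1]"]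
    by (simp add: full_twist_def half_twist_def)
next
  case 2
  then show ?thesis
    using braid_eq_cancel[of "[sig1, sig2, sig1, sig1, sig2]" S1 True "[]"]
    by (simp add: full_twist_def half_twist_def)
next
  case 3
  then show ?thesis by (simp add: full_twist_def half_twist_def)
next
  case 4
  have "braid_eq (full_twist @ [sig2_inv]) ([sig1, sig2] @ [sig1, sig2, sig1] @ [sig2, sig2_inv])"
    using braid_eq.cong[OF braid_eq.braid, of "[sig1, sig2, sig1]" "[sig2_inv]"]
    by (simp add: full_twist_def half_twist_def)
  also have "braid_eq \<dots> ([sig1, sig2] @ [sig1, sig2, sig1])"
    using braid_eq_cancel[of "[sig1, sig2] @ [sig1, sig2, sig1]" S2 True "[]"] by simp
  finally show ?thesis using 4 by (simp add: half_twist_def)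
qed

definition push_letter :: "gen \<times> bool \<Rightarrow> int \<times> syllable list \<Rightarrow> int \<times> syllable list" where
  "push_letter x st =
     push_syl (snd (letter_syls x)) (push_syl (fst (letter_syls x)) (fst st - 1, snd st))"

lemma push_letter_braid_eq: "braid_eq (nf_word st @ [x]) (nf_word (push_letter x st))"
proof -
  obtain k r where st: "st = (k, r)" by force
  let ?G = "concat (map syl_word (rev r))"
  define s1 s2 where "s1 = fst (letter_syls x)" and "s2 = snd (letter_syls x)"
  have "braid_eq (nf_word st @ [x]) (nf_word st @ (word_inv full_twist @ full_twist) @ [x])"
    using braid_eq.cong[OF braid_eq.sym[OF braid_eq_word_inv_left], of "nf_word st" "[x]"]
    by simp
  also have "braid_eq \<dots> (nf_word st @ word_inv full_twist @ syl_word s1 @ syl_word s2)"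
    using braid_eq.cong[OF full_twist_letter, of "nf_word st @ word_inv full_twist" x "[]"]
    by (simp add: s1_def s2_def)
  also have "braid_eq \<dots> ((nf_word (k - 1, r) @ syl_word s1) @ syl_word s2)"
    using full_twist_pow_absorb_inv[of k ?G "syl_word s1 @ syl_word s2"] by (simp add: st)
  also have "braid_eq \<dots> (nf_word (push_syl s1 (k - 1, r)) @ syl_word s2)"
    by (rule braid_eq_append[OF push_syl_braid_eq braid_eq.refl])
  also have "braid_eq \<dots> (nf_word (push_letter x st))"
    unfolding push_letter_def s1_def s2_def st by (simp add: push_syl_braid_eq)
  finally show ?thesis .
qed

definition normal_form :: "bword \<Rightarrow> int \<times> syllable list" where
  "normal_form w = fold push_letter w (0, [])"

lemma braid_eq_normal_form: "braid_eq w (nf_word (normal_form w))"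
proof -
  have "braid_eq (nf_word st @ w) (nf_word (fold push_letter w st))" for st
  proof (induction w arbitrary: st)
    case (Cons x w)
    have "braid_eq (nf_word st @ [x] @ w) (nf_word (push_letter x st) @ w)"
      using braid_eq_append[OF push_letter_braid_eq braid_eq.refl] by simp
    from braid_eq.trans[OF this Cons.IH] show ?case by simp
  qed simp
  from this[of "(0, [])"] show ?thesis
    by (simp add: normal_form_def)
qed

lemma alternating_push_syl: "alternating (snd st) \<Longrightarrow> alternating (snd (push_syl s st))"
proof -
  assume alt: "alternating (snd st)"
  obtain k r where st: "st = (k, r)" by force
  show ?thesis
  proof (cases r)
    case (Cons h r')
    with alt st show ?thesis
      by (cases s; cases h) (auto simp: successively_Cons)
  qed (cases s; simp add: st)
qed

lemma alternating_normal_form: "alternating (snd (normal_form w))"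
proof -
  have "alternating (snd st) \<Longrightarrow> alternating (snd (fold push_letter w st))" for st
  proof (induction w arbitrary: st)
    case (Cons x w)
    have "alternating (snd (push_letter x st))"
      unfolding push_letter_def by (intro alternating_push_syl) (use Cons.prems in simp)
    then show ?case using Cons.IH by simp
  qed simp
  then show ?thesis by (simp add: normal_form_def)
qed

section \<open>Ping-pong at \<open>t = -1\<close>\<close>

fun syl_act :: "syllable \<Rightarrow> real \<times> real \<Rightarrow> real \<times> real" where
  "syl_act Sx (p, q) = (q, -p)"
| "syl_act Sy (p, q) = (q, q - p)"
| "syl_act Syy (p, q) = (q - p, -p)"

text \<open>Ping-pong sets: \<open>x\<close> maps \<open>pq > 0\<close> into \<open>pq < 0\<close>, and \<open>y, y\<^sup>2\<close> map \<open>pq < 0\<close> into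
  \<open>pq > 0\<close>, always avoiding the diagonals \<open>p = \<plusminus>q\<close>; this is what prevents a scalar image of
  \<open>(\<plusminus>1, 1)\<close>.\<close>

definition ping_dom :: "syllable \<Rightarrow> real \<times> real \<Rightarrow> bool" where
  "ping_dom s v \<longleftrightarrow>
     (if is_y s then fst v * snd v < 0 else fst v * snd v > 0 \<and> (fst v)\<^sup>2 \<noteq> (snd v)\<^sup>2)"

definition ping_cod :: "syllable \<Rightarrow> real \<times> real \<Rightarrow> bool" where
  "ping_cod s v \<longleftrightarrow>
     (fst v)\<^sup>2 \<noteq> (snd v)\<^sup>2 \<and> (if is_y s then fst v * snd v > 0 else fst v * snd v < 0)"

lemma ping_cod_syl_act: "ping_dom s v \<Longrightarrow> ping_cod s (syl_act s v)"
proof -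
  assume dom: "ping_dom s v"
  obtain p q where v: "v = (p, q)" by force
  have squares: "0 \<le> p * p" "0 \<le> q * q" by simp_all
  show ?thesis
  proof (cases s)
    case Sx
    with dom v show ?thesis by (auto simp: ping_dom_def ping_cod_def power2_eq_square algebra_simps)
  next
    case Sy
    with dom v show ?thesis
      by (auto simp: ping_dom_def ping_cod_def power2_eq_square algebra_simps; insert squares; linarith)
  next
    case Syy
    with dom v show ?thesis
      by (auto simp: ping_dom_def ping_cod_def power2_eq_square algebra_simps; insert squares; linarith)
  qed
qed

lemma ping_dom_if_cod: "is_y s \<noteq> is_y s' \<Longrightarrow> ping_cod s v \<Longrightarrow> ping_dom s' v"
  by (auto simp: ping_cod_def ping_dom_def split: if_splits)

lemma ping_pong:
  "alternating r \<Longrightarrow> r \<noteq> [] \<Longrightarrow> ping_dom (hd r) v \<Longrightarrow> ping_cod (last r) (fold syl_act r v)"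
proof (induction r arbitrary: v)
  case (Cons s r)
  show ?case
  proof (cases r)
    case Nil
    with Cons.prems show ?thesis by (simp add: ping_cod_syl_act)
  next
    case (Cons s' r')
    with Cons.prems have "ping_dom (hd r) (syl_act s v)" "alternating r"
      by (auto intro: ping_dom_if_cod ping_cod_syl_act)
    with Cons.IH Cons show ?thesis by simp
  qed
qed simp

definition real_vec :: "real \<times> real \<Rightarrow> complex^2" where
  "real_vec v = vector [of_real (fst v), of_real (snd v)]"

lemma vector2_eq_iff: "(vector [a, b] :: 'a::zero^2) = vector [c, d] \<longleftrightarrow> a = c \<and> b = d"
  by (simp add: vec_eq_iff forall_2)

lemma mk2_mult_vector: "mk2 a b c d *v vector [x, y] = vector [a * x + b * y, c * x + d * y]"
  by (simp add: vec_eq_iff forall_2 matrix_vector_mult_def sum_2)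

lemma burau_syl_word_real_vec: "burau (-1) (syl_word s) *v real_vec v = real_vec (syl_act s v)"
  by (cases s; cases v)
    (simp_all add: half_twist_def mat_1_eq_mk2 mk2_mult_vector real_vec_def vector2_eq_iff)

lemma burau_syllables_real_vec:
  "burau (-1) (concat (map syl_word (rev r))) *v real_vec v = real_vec (fold syl_act r v)"
proof (induction r arbitrary: v)
  case (Cons s r)
  then show ?case
    by (simp add: matrix_vector_mul_assoc[symmetric] burau_syl_word_real_vec)
qed simp

lemma alternating_moves_diagonal:
  assumes "alternating r" "r \<noteq> []" "r \<noteq> [Sx]"
  obtains p where "p\<^sup>2 = 1" "(fst (fold syl_act r (p, 1)))\<^sup>2 \<noteq> (snd (fold syl_act r (p, 1)))\<^sup>2"
proof (cases "is_y (hd r)")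
  case True
  then have "ping_cod (last r) (fold syl_act r (-1, 1))"
    using assms(1,2) by (intro ping_pong) (simp_all add: ping_dom_def)
  then show ?thesis
    by (intro that[of "-1"]) (simp_all add: ping_cod_def)
next
  case False
  with assms(2) obtain r' where r: "r = Sx # r'"
    by (cases r rule: list.exhaust; cases "hd r") auto
  with assms(1,3) have "alternating r'" "r' \<noteq> []" "is_y (hd r')"
    by (auto simp: successively_Cons)
  then have "ping_cod (last r') (fold syl_act r' (1, -1))"
    by (intro ping_pong) (simp_all add: ping_dom_def)
  then show ?thesis
    by (intro that[of 1]) (simp_all add: r ping_cod_def)
qed

lemma burau_alternating_not_scalar:
  assumes "alternating r" "r \<noteq> []"
  shows "burau (-1) (concat (map syl_word (rev r))) \<noteq> mk2 c 0 0 c"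
proof
  assume scalar: "burau (-1) (concat (map syl_word (rev r))) = mk2 c 0 0 c"
  have fold_eq: "of_real (fst (fold syl_act r (p, q))) = c * of_real p"
    "of_real (snd (fold syl_act r (p, q))) = c * of_real q" for p q
    using burau_syllables_real_vec[of r "(p, q)"] unfolding scalar
    by (simp_all add: mk2_mult_vector real_vec_def vector2_eq_iff)
  show False
  proof (cases "r = [Sx]")
    case True
    then show False using fold_eq(1)[of 0 1] by simp
  next
    case False
    with assms obtain p where p: "p\<^sup>2 = 1"
      and moved: "(fst (fold syl_act r (p, 1)))\<^sup>2 \<noteq> (snd (fold syl_act r (p, 1)))\<^sup>2"
      by (rule alternating_moves_diagonal)
    have "(complex_of_real p)\<^sup>2 = 1"
      using p by (metis of_real_power of_real_1)
    then have "complex_of_real ((fst (fold syl_act r (p, 1)))\<^sup>2) = of_real ((snd (fold syl_act r (p, 1)))\<^sup>2)"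
      by (simp only: of_real_power fold_eq) (simp add: power_mult_distrib)
    with moved show False
      by (simp only: of_real_eq_iff)
  qed
qed

section \<open>Faithfulness away from the extended singular set\<close>

lemma kernel_lower_left_eq_0:
  assumes "t0 \<noteq> 0" "- t0 \<notin> singular_set" "burau t0 w = mat 1"
  shows "burau (-1) w $ 2 $ 1 = 0"
proof (rule ccontr)
  assume lower_left: "burau (-1) w $ 2 $ 1 \<noteq> 0"
  let ?as = "map letter_exps w"
  have "Mq ?as (- t0) = mat 1" "Mq ?as 1 = burau (-1) w"
    using burau_eq_Mq[OF assms(1), of w] burau_eq_Mq[of "-1" w] assms(3) by simp_all
  with assms(1) lower_left have "- t0 \<in> singular_set"
    by (intro in_singular_setI[of "- t0" ?as]) (simp_all add: qnum_def qden_def mat_1_eq_mk2)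
  with assms(2) show False by simp
qed

lemma kernel_scalar_at_minus_one:
  assumes "t0 \<noteq> 0" "- t0 \<notin> singular_set" "burau t0 w = mat 1"
  shows "\<exists>c. burau (-1) w = mk2 c 0 0 c"
proof -
  have conj: "burau (-1) ([(S2, b)] @ w @ [(S2, \<not> b)]) $ 2 $ 1 = 0" for b
  proof (rule kernel_lower_left_eq_0[OF assms(1,2)])
    have "burau t0 ([(S2, b)] @ w @ [(S2, \<not> b)]) = burau t0 [(S2, b), (S2, \<not> b)]"
      using assms(3) by simp
    also have "\<dots> = mat 1"
      using burau_braid_eq[OF braid_eq.cancel assms(1)] by simp
    finally show "burau t0 ([(S2, b)] @ w @ [(S2, \<not> b)]) = mat 1" .
  qed
  obtain a b d where M: "burau (-1) w = mk2 a b 0 d"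
    using kernel_lower_left_eq_0[OF assms] mk2_entries by metis
  have "d - a - b = 0" "a - b - d = 0"
    using conj[of True] conj[of False] by (simp_all add: M algebra_simps)
  moreover have "(d - a - b) + (a - b - d) = - 2 * b" "(d - a - b) - (a - b - d) = 2 * (d - a)"
    by (simp_all add: algebra_simps)
  ultimately have "b = 0" "d = a" by simp_all
  with M show ?thesis by blast
qed

lemma scalar_at_minus_one_imp_full_twist_pow:
  assumes "burau (-1) w = mk2 c 0 0 c"
  shows "\<exists>k. braid_eq w (word_pow full_twist k)"
proof -
  obtain k r where nf: "normal_form w = (k, r)" by force
  define d :: complex where "d = (-1) powi k"
  obtain g11 g12 g21 g22 where G: "burau (-1) (concat (map syl_word (rev r))) = mk2 g11 g12 g21 g22"
    using mk2_entries by metis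
  have "d \<noteq> 0" by (simp add: d_def)
  have "burau (-1) w = burau (-1) (nf_word (k, r))"
    using burau_braid_eq[OF braid_eq_normal_form[of w]] by (simp add: nf)
  also have "\<dots> = mk2 d 0 0 d ** mk2 g11 g12 g21 g22"
    using burau_word_pow_scalar[OF _ burau_full_twist, of "-1" k] by (simp add: G d_def)
  finally have "mk2 c 0 0 c = mk2 d 0 0 d ** mk2 g11 g12 g21 g22"
    by (simp only: assms)
  then have "d * g12 = 0" "d * g21 = 0" "d * g22 = d * g11"
    by auto
  with \<open>d \<noteq> 0\<close> have "burau (-1) (concat (map syl_word (rev r))) = mk2 g11 0 0 g11"
    by (simp add: G)
  then have "r = []"
    using burau_alternating_not_scalar alternating_normal_form[of w] nf by fastforce
  then show ?thesis
    using braid_eq_normal_form[of w] nf by auto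
qed

lemma kernel_trivial:
  assumes "t0 \<noteq> 0" "- t0 \<notin> ext_singular_set" "burau t0 w = mat 1"
  shows "braid_eq w []"
proof -
  have not_sing: "- t0 \<notin> singular_set" "- t0 \<noteq> 1"
    using assms(2) by (auto simp: ext_singular_set_def)
  obtain k where k: "braid_eq w (word_pow full_twist k)"
    using kernel_scalar_at_minus_one[OF assms(1) not_sing(1) assms(3)]
      scalar_at_minus_one_imp_full_twist_pow by blast
  have "burau t0 (word_pow full_twist k) = mat 1"
    using burau_braid_eq[OF k assms(1)] assms(3) by simp
  then have "(t0 ^ 3) powi k = 1"
    using burau_word_pow_scalar[OF assms(1) burau_full_twist] by (simp add: mat_1_eq_mk2)
  then have "(t0 ^ 3) powi \<bar>k\<bar> = 1"
    by (cases "0 \<le> k") (auto simp: power_int_minus)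
  then have "t0 ^ (3 * nat \<bar>k\<bar>) = 1"
    by (metis power_mult power_int_of_nat nat_0_le abs_ge_zero)
  then have "(- t0) ^ (6 * nat \<bar>k\<bar>) = 1"
    by (metis power_mult power_minus_even power_one even_numeral numeral_Bit0_eq_double mult.commute)
  with not_sing have "k = 0"
    using root_of_unity_in_singular_set[of "- t0" "6 * nat \<bar>k\<bar>"] by fastforce
  with k show ?thesis by simp
qed

lemma burau_faithfulI:
  assumes "t \<noteq> 0" "\<And>w. burau t w = mat 1 \<Longrightarrow> braid_eq w []"
  shows "burau_faithful t"
  unfolding burau_faithful_def
proof (intro allI impI)
  fix w1 w2
  assume "burau t w1 = burau t w2"
  then have "burau t (w1 @ word_inv w2) = mat 1"
    using burau_word_inv_right[OF assms(1)] by simp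
  then have "braid_eq (w1 @ word_inv w2) []" by (rule assms(2))
  have "braid_eq w1 (w1 @ word_inv w2 @ w2)"
    using braid_eq_append[OF braid_eq.refl braid_eq.sym[OF braid_eq_word_inv_left], of w1 w2] by simp
  also have "braid_eq \<dots> w2"
    using braid_eq_append[OF \<open>braid_eq (w1 @ word_inv w2) []\<close> braid_eq.refl, of w2] by simp
  finally show "braid_eq w1 w2" .
qed

section \<open>Non-faithfulness on the extended singular set\<close>

lemma not_burau_faithful_minus_one: "\<not> burau_faithful (-1)"
proof
  assume "burau_faithful (-1)"
  moreover have "burau (-1) (full_twist @ full_twist) = burau (-1) []"
    by (simp add: burau_full_twist mat_1_eq_mk2)
  ultimately have "braid_eq (full_twist @ full_twist) []"
    unfolding burau_faithful_def by blast
  then have "exp_sum (full_twist @ full_twist) = exp_sum []"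
    by (rule exp_sum_braid_eq)
  then show False
    by (simp add: exp_sum_def full_twist_def half_twist_def)
qed

lemma commutator_sig1_unitriangular:
  assumes "t \<noteq> 0" "P $ 2 $ 1 = 0" "P ** Q = mat 1"
  shows "\<exists>u. P ** (burau_gen t sig1 ** (Q ** burau_gen t sig1_inv)) = mk2 1 u 0 1"
proof -
  obtain a b d where P: "P = mk2 a b 0 d"
    using assms(2) mk2_entries by metis
  obtain e f g h where Q: "Q = mk2 e f g h"
    using mk2_entries by metis
  from assms(3) have "a * e + b * g = 1" "d * g = 0" "d * h = 1"
    by (simp_all add: P Q mat_1_eq_mk2)
  then have "g = 0" "a * e = 1" "d * h = 1"
    by auto
  with assms(1) show ?thesis
    by (intro exI[of _ "a * (h - e - t * f) + b * h"]) (simp add: P Q field_simps)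
qed

lemma commutator_sig1_lower_left_minus_one:
  assumes "M ** N = mat 1" "det M = 1"
  shows "(M ** (burau_gen (-1) sig1 ** (N ** burau_gen (-1) sig1_inv))) $ 2 $ 1 = - (M $ 2 $ 1)\<^sup>2"
proof -
  obtain a b c d where M: "M = mk2 a b c d"
    using mk2_entries by metis
  show ?thesis
    using inverse_eq_adjugate[OF assms] by (simp add: M power2_eq_square algebra_simps)
qed

lemma conj_sig1_not_commute_minus_one:
  assumes "A $ 2 $ 1 \<noteq> 0"
  defines "B \<equiv> burau_gen (-1) sig1 ** (A ** burau_gen (-1) sig1_inv)"
  shows "A ** B \<noteq> B ** A"
proof
  obtain a b c d where A: "A = mk2 a b c d"
    using mk2_entries by metis
  assume "A ** B = B ** A"
  then have "(A ** B) $ 2 $ 1 - (B ** A) $ 2 $ 1 = 0" by simp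
  moreover have "(A ** B) $ 2 $ 1 - (B ** A) $ 2 $ 1 = 2 * c * c"
    by (simp add: A B_def algebra_simps)
  ultimately show False
    using assms(1) by (simp add: A)
qed

lemma not_burau_faithful_at_pole:
  assumes "t0 \<noteq> 0" "- t0 \<in> singular_set"
  shows "\<not> burau_faithful t0"
proof
  assume faithful: "burau_faithful t0"
  obtain as where den1: "qden as 1 \<noteq> 0" and pole: "is_pole (\<lambda>q. qnum as q / qden as q) (- t0)"
    using assms(2) unfolding singular_set_def by blast
  define W where "W = exps_word as"
  define U where "U = W @ [sig1] @ word_inv W @ [sig1_inv]"
  define V where "V = [sig1] @ U @ [sig1_inv]"
  have "burau t0 W $ 2 $ 1 = 0"
    using qden_eq_0_at_pole[OF _ pole] assms(1) burau_exps_word[OF assms(1), of as]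
    by (simp add: W_def qden_def)
  then obtain u where "burau t0 U = mk2 1 u 0 1"
    using commutator_sig1_unitriangular[OF assms(1) _ burau_word_inv_right[OF assms(1)]]
    by (fastforce simp: U_def)
  with assms(1) have "burau t0 (U @ V) = burau t0 (V @ U)"
    by (simp add: V_def field_simps)
  with faithful have "braid_eq (U @ V) (V @ U)"
    unfolding burau_faithful_def by blast
  then have "burau (-1) U ** burau (-1) V = burau (-1) V ** burau (-1) U"
    using burau_braid_eq[of "U @ V" "V @ U" "-1"] by simp
  moreover have "burau (-1) U $ 2 $ 1 \<noteq> 0"
    using commutator_sig1_lower_left_minus_one[OF burau_word_inv_right det_burau_minus_one, of W]
      burau_exps_word[of "-1" as] den1
    by (simp add: U_def W_def qden_def)
  ultimately show False
    using conj_sig1_not_commute_minus_one by (simp add: V_def)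
qed

theorem theorem1:
  fixes t0 :: complex
  assumes "t0 \<noteq> 0"
  shows "burau_faithful t0 \<longleftrightarrow> - t0 \<notin> ext_singular_set"
proof
  assume faithful: "burau_faithful t0"
  have "- t0 \<noteq> 1"
    using faithful not_burau_faithful_minus_one by (metis minus_minus)
  moreover have "- t0 \<notin> singular_set"
    using faithful not_burau_faithful_at_pole[OF assms] by blast
  ultimately show "- t0 \<notin> ext_singular_set"
    by (auto simp: ext_singular_set_def)
next
  assume "- t0 \<notin> ext_singular_set"
  then show "burau_faithful t0"
    using kernel_trivial[OF assms] by (intro burau_faithfulI[OF assms])
qed

end
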